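(* Let $(M^4,g,I,J)$ be a nondegenerate rank $2$ generalized Kähler-Ricci soliton on a real $4$-manifold. Let $\varphi=\varphi(\nu^I_+,\nu^J_+)$ and $\psi=\psi(\nu^I_-,\nu^J_-)$ be the locally defined $\mathfrak t$-invariant potential functions, $\mathfrak t=\mathrm{span}_{\mathbb R}\{X_I,X_J\}$, determined up to constants by $$\frac{\partial\varphi}{\partial\nu^I_+}=-\nu^J_-,\quad\frac{\partial\varphi}{\partial\nu^J_+}=\nu^I_-,\quad\frac{\partial\psi}{\partial\nu^I_-}=\nu^J_+,\quad\frac{\partial\psi}{\partial\nu^J_-}=-\nu^I_+ .$$ Then $$\det(\mathrm{Hess}(\varphi))=e^{2\left(\nu^J_+-\nu^I_+-\varphi_{\nu^J_+}+\varphi_{\nu^I_+}\right)},\qquad \det(\mathrm{Hess}(\psi))=e^{2\left(\nu^I_-+\nu^J_--\psi_{\nu^I_-}-\psi_{\nu^J_-}\right)},$$ where $\mathrm{Hess}(\varphi)$ is the Hessian in the coordinates $(\nu^I_+,\nu^J_+)$ and $\mathrm{Hess}(\psi)$ the Hessian in the coordinates $(\nu^I_-,\nu^J_-)$.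
   Context: For a metric $g$ with compatible complex structure $J$ on a real $4$-manifold: $\omega_J(X,Y)=g(JX,Y)$, $d^c_J=\sqrt{-1}(\bar\partial_J-\partial_J)$, Lee form $\theta_J$ defined by $d\omega_J=\theta_J\wedge\omega_J$. A generalized Kähler structure $(g,I,J)$ is a metric with two compatible integrable complex structures with $d^c_I\omega_I=H=-d^c_J\omega_J$, $dH=0$. It is a generalized Kähler-Ricci soliton with potential $f$ if $\mathrm{Rc}^{\nabla^+}+\nabla^+\nabla^+f=0$, $\nabla^+=\nabla+\tfrac12g^{-1}H$. Canonical soliton vector fields (commuting and preserving $g,I,J$): $X_I=\tfrac12I(\theta_I^\sharp-\nabla f)$, $X_J=\tfrac12J(\theta_J^\sharp-\nabla f)$. Rank: $\sup_p\dim\mathrm{span}\{X_I(p),X_J(p)\}$. Nondegenerate: $\sigma=\tfrac12[I,J]g^{-1}$ is invertible everywhere; $\Omega=\sigma^{-1}$, i.e. $\Omega(X,Y)=g(K^{-1}X,Y)$ with $K=\tfrac12[I,J]$; $\Omega$ is a symplectic form. Local momenta: functions with $\iota_{X_I}\Omega=d\nu^I_1$, $\iota_{IX_I}\Omega=d\nu^I_2$, $\iota_{JX_I}\Omega=d\nu^I_3$, and $\iota_{X_J}\Omega=d\nu^J_1$, $\iota_{IX_J}\Omega=d\nu^J_2$, $\iota_{JX_J}\Omega=d\nu^J_3$; $\nu^I_\pm=\tfrac12(\nu^I_2\pm\nu^I_3)$, $\nu^J_\pm=\tfrac12(\nu^J_2\pm\nu^J_3)$. Locally, each of the pairs $(\nu^I_+,\nu^J_+)$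 and $(\nu^I_-,\nu^J_-)$ gives coordinates on the space of local $\mathfrak t$-orbits. With the angle function $p=-\tfrac14\mathrm{tr}(IJ)$, the Ricci potential is $\Phi=\log\frac{1-p}{1+p}$, and $\Phi=2\nu^J_3-2\nu^I_2+\mathrm{const}$; the additive constants in the momenta are chosen so that $\Phi=2\nu^J_3-2\nu^I_2$, i.e. $\Phi=2(\nu^J_+-\nu^J_--\nu^I_+-\nu^I_-)$. *)

theory Defs
  imports "HOL-Analysis.Analysis"
begin

section \<open>Smooth functions on open subsets of Euclidean space\<close>

definition pd :: "'n::finite \<Rightarrow> (real^'n \<Rightarrow> real) \<Rightarrow> real^'n \<Rightarrow> real" where
  "pd i f x = frechet_derivative f (at x) (axis i 1)"

primrec Ck_on :: "nat \<Rightarrow> (real^'n::finite) set \<Rightarrow> (real^'n \<Rightarrow> real) \<Rightarrow> bool" where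
  "Ck_on 0 S f \<longleftrightarrow> continuous_on S f"
| "Ck_on (Suc k) S f \<longleftrightarrow> (\<forall>x\<in>S. f differentiable (at x)) \<and> (\<forall>i. Ck_on k S (pd i f))"

text \<open>Differentiability is required in a full neighbourhood of each point, so \<open>S\<close> is meant to be open.\<close>
definition smooth_on :: "(real^'n::finite) set \<Rightarrow> (real^'n \<Rightarrow> real) \<Rightarrow> bool" where
  "smooth_on S f \<longleftrightarrow> (\<forall>k. Ck_on k S f)"

definition hessian :: "(real^'n::finite \<Rightarrow> real) \<Rightarrow> real^'n \<Rightarrow> real^'n^'n" where
  "hessian f x = (\<chi> i j. pd i (pd j f) x)"

definition gradient_covector :: "(real^'n::finite \<Rightarrow> real) \<Rightarrow> real^'n \<Rightarrow> real^'n" where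
  "gradient_covector f x = (\<chi> i. pd i f x)"


section \<open>Smooth 4-manifolds and fields on them\<close>

datatype 'a chart = Chart (chart_dom: "'a set") (chart_map: "'a \<Rightarrow> real^4")

definition chart_img :: "'a chart \<Rightarrow> (real^4) set" where
  "chart_img c = chart_map c ` chart_dom c"

definition chart_inv :: "'a chart \<Rightarrow> real^4 \<Rightarrow> 'a" where
  "chart_inv c = inv_into (chart_dom c) (chart_map c)"

definition chart_overlap :: "'a chart \<Rightarrow> 'a chart \<Rightarrow> (real^4) set" where
  "chart_overlap c c' = chart_map c ` (chart_dom c \<inter> chart_dom c')"

definition transition :: "'a chart \<Rightarrow> 'a chart \<Rightarrow> real^4 \<Rightarrow> real^4" where
  "transition c c' = chart_map c' \<circ> chart_inv c"

definition is_chart :: "'a topology \<Rightarrow> 'a chart \<Rightarrow> bool" where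
  "is_chart M c \<longleftrightarrow>
     openin M (chart_dom c) \<and> open (chart_img c) \<and>
     homeomorphic_map (subtopology M (chart_dom c)) (top_of_set (chart_img c)) (chart_map c)"

definition smooth_4_manifold :: "'a topology \<Rightarrow> 'a chart set \<Rightarrow> bool" where
  "smooth_4_manifold M A \<longleftrightarrow>
     Hausdorff_space M \<and> second_countable M \<and>
     (\<forall>c\<in>A. is_chart M c) \<and> topspace M = (\<Union>c\<in>A. chart_dom c) \<and>
     (\<forall>c\<in>A. \<forall>c'\<in>A. \<forall>i. smooth_on (chart_overlap c c') (\<lambda>x. transition c c' x $ i))"

text \<open>Functions are functions on the manifold, with local representative \<open>local_rep f c\<close>.
  Tensor fields are given by their components in every chart of the atlas, as functions
  on the image of the chart, subject to the transformation law. In the chart \<open>c\<close>, at the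
  coordinate point \<open>x\<close>, a 2-tensor \<open>T\<close> has \<open>T(e\<^sub>i,e\<^sub>j) = T c x $ i $ j\<close>, and an
  endomorphism field \<open>E\<close> maps \<open>v\<close> to \<open>E c x *v v\<close>.\<close>

definition local_rep :: "('a \<Rightarrow> real) \<Rightarrow> 'a chart \<Rightarrow> real^4 \<Rightarrow> real" where
  "local_rep f c = f \<circ> chart_inv c"

definition smooth_function_on :: "'a chart set \<Rightarrow> 'a set \<Rightarrow> ('a \<Rightarrow> real) \<Rightarrow> bool" where
  "smooth_function_on A W f \<longleftrightarrow>
     (\<forall>c\<in>A. smooth_on (chart_map c ` (chart_dom c \<inter> W)) (local_rep f c))"

definition smooth_components :: "'a chart set \<Rightarrow> ('a chart \<Rightarrow> real^4 \<Rightarrow> real^4^4) \<Rightarrow> bool" where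
  "smooth_components A T \<longleftrightarrow> (\<forall>c\<in>A. \<forall>i j. smooth_on (chart_img c) (\<lambda>x. T c x $ i $ j))"

definition covariant_2_tensor :: "'a chart set \<Rightarrow> ('a chart \<Rightarrow> real^4 \<Rightarrow> real^4^4) \<Rightarrow> bool" where
  "covariant_2_tensor A T \<longleftrightarrow> smooth_components A T \<and>
     (\<forall>c\<in>A. \<forall>c'\<in>A. \<forall>x\<in>chart_overlap c c'.
        let D = jacobian (transition c c') (at x)
        in T c x = transpose D ** T c' (transition c c' x) ** D)"

definition endomorphism_field :: "'a chart set \<Rightarrow> ('a chart \<Rightarrow> real^4 \<Rightarrow> real^4^4) \<Rightarrow> bool" where
  "endomorphism_field A E \<longleftrightarrow> smooth_components A E \<and>
     (\<forall>c\<in>A. \<forall>c'\<in>A. \<forall>x\<in>chart_overlap c c'.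
        let D = jacobian (transition c c') (at x)
        in D ** E c x = E c' (transition c c' x) ** D)"


section \<open>Hermitian geometry in a chart\<close>

definition lie_bracket ::
    "(real^'n::finite \<Rightarrow> real^'n) \<Rightarrow> (real^'n \<Rightarrow> real^'n) \<Rightarrow> real^'n \<Rightarrow> real^'n" where
  "lie_bracket V W x =
     (\<chi> k. \<Sum>i\<in>UNIV. V x $ i * pd i (\<lambda>y. W y $ k) x - W x $ i * pd i (\<lambda>y. V y $ k) x)"

text \<open>\<open>N(X,Y) = [JX,JY] - J[JX,Y] - J[X,JY] - [X,Y]\<close> on the coordinate fields
  \<open>X = e\<^sub>a\<close>, \<open>Y = e\<^sub>b\<close>.\<close>
definition nijenhuis ::
    "(real^'n::finite \<Rightarrow> real^'n^'n) \<Rightarrow> real^'n \<Rightarrow> 'n \<Rightarrow> 'n \<Rightarrow> real^'n" where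
  "nijenhuis J x a b =
     (let X = (\<lambda>y. axis a 1); Y = (\<lambda>y. axis b 1);
          JX = (\<lambda>y. J y *v axis a 1); JY = (\<lambda>y. J y *v axis b 1)
      in lie_bracket JX JY x - J x *v lie_bracket JX Y x
         - J x *v lie_bracket X JY x - lie_bracket X Y x)"

definition riemannian_at :: "real^'n^'n::finite \<Rightarrow> bool" where
  "riemannian_at G \<longleftrightarrow> transpose G = G \<and> (\<forall>v. v \<noteq> 0 \<longrightarrow> v \<bullet> (G *v v) > 0)"

text \<open>The matrix of \<open>\<omega>\<^sub>J(X,Y) = g(JX,Y)\<close>.\<close>
definition kahler_form ::
    "(real^'n::finite \<Rightarrow> real^'n^'n) \<Rightarrow> (real^'n \<Rightarrow> real^'n^'n) \<Rightarrow> real^'n \<Rightarrow> real^'n^'n" where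
  "kahler_form g J x = transpose (J x) ** g x"

definition ext_deriv_2 ::
    "(real^'n::finite \<Rightarrow> real^'n^'n) \<Rightarrow> real^'n \<Rightarrow> 'n \<Rightarrow> 'n \<Rightarrow> 'n \<Rightarrow> real" where
  "ext_deriv_2 w x i j k =
     pd i (\<lambda>y. w y $ j $ k) x + pd j (\<lambda>y. w y $ k $ i) x + pd k (\<lambda>y. w y $ i $ j) x"

definition ext_deriv_3 ::
    "(real^'n::finite \<Rightarrow> 'n \<Rightarrow> 'n \<Rightarrow> 'n \<Rightarrow> real) \<Rightarrow> real^'n \<Rightarrow> 'n \<Rightarrow> 'n \<Rightarrow> 'n \<Rightarrow> 'n \<Rightarrow> real" where
  "ext_deriv_3 H x i j k l =
     pd i (\<lambda>y. H y j k l) x - pd j (\<lambda>y. H y i k l) x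
     + pd k (\<lambda>y. H y i j l) x - pd l (\<lambda>y. H y i j k) x"

definition wedge_1_2 :: "real^'n::finite \<Rightarrow> real^'n^'n \<Rightarrow> 'n \<Rightarrow> 'n \<Rightarrow> 'n \<Rightarrow> real" where
  "wedge_1_2 \<theta> w i j k = \<theta> $ i * w $ j $ k + \<theta> $ j * w $ k $ i + \<theta> $ k * w $ i $ j"

text \<open>In real dimension 4 the Lee form is uniquely determined at each point, since wedging
  with \<open>\<omega>\<^sub>J\<close> is an isomorphism from 1-forms to 3-forms.\<close>
definition lee_form ::
    "(real^4 \<Rightarrow> real^4^4) \<Rightarrow> (real^4 \<Rightarrow> real^4^4) \<Rightarrow> real^4 \<Rightarrow> real^4" where
  "lee_form g J x =
     (THE \<theta>. \<forall>i j k. ext_deriv_2 (kahler_form g J) x i j k = wedge_1_2 \<theta> (kahler_form g J x) i j k)"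

text \<open>Projections of the complexified tangent space onto its (1,0) and (0,1) parts.\<close>
definition proj10 :: "real^'n^'n::finite \<Rightarrow> complex^'n^'n" where
  "proj10 J = (\<chi> a b. (of_bool (a = b) - \<i> * of_real (J $ a $ b)) / 2)"

definition proj01 :: "real^'n^'n::finite \<Rightarrow> complex^'n^'n" where
  "proj01 J = (\<chi> a b. (of_bool (a = b) + \<i> * of_real (J $ a $ b)) / 2)"

text \<open>Components of \<open>(X,Y,Z) \<mapsto> \<alpha>(PX,QY,RZ)\<close>, with \<open>\<alpha>\<close> extended complex trilinearly.\<close>
definition compose_3 ::
    "('n::finite \<Rightarrow> 'n \<Rightarrow> 'n \<Rightarrow> real) \<Rightarrow> complex^'n^'n \<Rightarrow> complex^'n^'n \<Rightarrow> complex^'n^'n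
      \<Rightarrow> 'n \<Rightarrow> 'n \<Rightarrow> 'n \<Rightarrow> complex" where
  "compose_3 \<alpha> P Q R i j k =
     (\<Sum>a\<in>UNIV. \<Sum>b\<in>UNIV. \<Sum>c\<in>UNIV. of_real (\<alpha> a b c) * P $ a $ i * Q $ b $ j * R $ c $ k)"

text \<open>For a form \<open>w\<close> of type (1,1), such as \<open>\<omega>\<^sub>J\<close>, the forms \<open>\<partial>\<^sub>J w\<close> and
  \<open>\<partial>bar\<^sub>J w\<close> are the components of \<open>dw\<close> of type (2,1) and (1,2).\<close>
definition del_11 ::
    "(real^'n::finite \<Rightarrow> real^'n^'n) \<Rightarrow> (real^'n \<Rightarrow> real^'n^'n) \<Rightarrow> real^'n
      \<Rightarrow> 'n \<Rightarrow> 'n \<Rightarrow> 'n \<Rightarrow> complex" where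
  "del_11 J w x i j k =
     (let P = proj10 (J x); Q = proj01 (J x); \<alpha> = ext_deriv_2 w x
      in compose_3 \<alpha> P P Q i j k + compose_3 \<alpha> P Q P i j k + compose_3 \<alpha> Q P P i j k)"

definition delbar_11 ::
    "(real^'n::finite \<Rightarrow> real^'n^'n) \<Rightarrow> (real^'n \<Rightarrow> real^'n^'n) \<Rightarrow> real^'n
      \<Rightarrow> 'n \<Rightarrow> 'n \<Rightarrow> 'n \<Rightarrow> complex" where
  "delbar_11 J w x i j k =
     (let P = proj10 (J x); Q = proj01 (J x); \<alpha> = ext_deriv_2 w x
      in compose_3 \<alpha> Q Q P i j k + compose_3 \<alpha> Q P Q i j k + compose_3 \<alpha> P Q Q i j k)"

definition dc_kahler_form ::
    "(real^'n::finite \<Rightarrow> real^'n^'n) \<Rightarrow> (real^'n \<Rightarrow> real^'n^'n) \<Rightarrow> real^'n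
      \<Rightarrow> 'n \<Rightarrow> 'n \<Rightarrow> 'n \<Rightarrow> complex" where
  "dc_kahler_form g J x i j k =
     \<i> * (delbar_11 J (kahler_form g J) x i j k - del_11 J (kahler_form g J) x i j k)"

text \<open>\<open>H = d\<^sup>c\<^sub>I \<omega>\<^sub>I\<close>. This is a real form, because \<open>\<partial>bar\<^sub>I \<omega>\<^sub>I\<close> and \<open>\<partial>\<^sub>I \<omega>\<^sub>I\<close> are
  complex conjugate.\<close>
definition torsion_form ::
    "(real^'n::finite \<Rightarrow> real^'n^'n) \<Rightarrow> (real^'n \<Rightarrow> real^'n^'n) \<Rightarrow> real^'n
      \<Rightarrow> 'n \<Rightarrow> 'n \<Rightarrow> 'n \<Rightarrow> real" where
  "torsion_form g I x i j k = Re (dc_kahler_form g I x i j k)"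

definition compatible_complex_structure_on ::
    "(real^'n::finite) set \<Rightarrow> (real^'n \<Rightarrow> real^'n^'n) \<Rightarrow> (real^'n \<Rightarrow> real^'n^'n) \<Rightarrow> bool" where
  "compatible_complex_structure_on S g J \<longleftrightarrow>
     (\<forall>x\<in>S. J x ** J x = - mat 1 \<and> transpose (J x) ** g x ** J x = g x \<and>
            (\<forall>a b. nijenhuis J x a b = 0))"


section \<open>The Bismut connection and its Ricci tensor in a chart\<close>

text \<open>\<open>\<nabla>\<^sub>i e\<^sub>j = (\<Sum>k. christoffel g x i j k * e\<^sub>k)\<close>, and likewise for \<open>bismut\<close>.\<close>
definition christoffel ::
    "(real^'n::finite \<Rightarrow> real^'n^'n) \<Rightarrow> real^'n \<Rightarrow> 'n \<Rightarrow> 'n \<Rightarrow> 'n \<Rightarrow> real" where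
  "christoffel g x i j k =
     (\<Sum>l\<in>UNIV. matrix_inv (g x) $ k $ l *
        (pd i (\<lambda>y. g y $ j $ l) x + pd j (\<lambda>y. g y $ i $ l) x - pd l (\<lambda>y. g y $ i $ j) x)) / 2"

definition bismut ::
    "(real^'n::finite \<Rightarrow> real^'n^'n) \<Rightarrow> (real^'n \<Rightarrow> 'n \<Rightarrow> 'n \<Rightarrow> 'n \<Rightarrow> real) \<Rightarrow> real^'n
      \<Rightarrow> 'n \<Rightarrow> 'n \<Rightarrow> 'n \<Rightarrow> real" where
  "bismut g H x i j k =
     christoffel g x i j k + (\<Sum>l\<in>UNIV. matrix_inv (g x) $ k $ l * H x i j l) / 2"

text \<open>\<open>curvature G x i j k l\<close> is the \<open>e\<^sub>l\<close>-component of
  \<open>\<nabla>\<^sub>i \<nabla>\<^sub>j e\<^sub>k - \<nabla>\<^sub>j \<nabla>\<^sub>i e\<^sub>k\<close>, and the Ricci tensor is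
  \<open>Rc(Y,Z) = tr (X \<mapsto> R(X,Y)Z)\<close>; it is not symmetric if the connection has torsion.\<close>
definition curvature ::
    "(real^'n::finite \<Rightarrow> 'n \<Rightarrow> 'n \<Rightarrow> 'n \<Rightarrow> real) \<Rightarrow> real^'n
      \<Rightarrow> 'n \<Rightarrow> 'n \<Rightarrow> 'n \<Rightarrow> 'n \<Rightarrow> real" where
  "curvature G x i j k l =
     pd i (\<lambda>y. G y j k l) x - pd j (\<lambda>y. G y i k l) x
     + (\<Sum>m\<in>UNIV. G x j k m * G x i m l - G x i k m * G x j m l)"

definition ricci ::
    "(real^'n::finite \<Rightarrow> 'n \<Rightarrow> 'n \<Rightarrow> 'n \<Rightarrow> real) \<Rightarrow> real^'n \<Rightarrow> 'n \<Rightarrow> 'n \<Rightarrow> real" where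
  "ricci G x j k = (\<Sum>i\<in>UNIV. curvature G x i j k i)"

text \<open>\<open>(\<nabla>\<nabla>f)(e\<^sub>j,e\<^sub>k) = (\<nabla>\<^sub>j df)(e\<^sub>k)\<close>.\<close>
definition covariant_hessian ::
    "(real^'n::finite \<Rightarrow> 'n \<Rightarrow> 'n \<Rightarrow> 'n \<Rightarrow> real) \<Rightarrow> (real^'n \<Rightarrow> real) \<Rightarrow> real^'n
      \<Rightarrow> 'n \<Rightarrow> 'n \<Rightarrow> real" where
  "covariant_hessian G f x j k = pd j (pd k f) x - (\<Sum>l\<in>UNIV. G x j k l * pd l f x)"


section \<open>Generalized Kaehler-Ricci solitons\<close>

definition generalized_kahler ::
    "'a chart set \<Rightarrow> ('a chart \<Rightarrow> real^4 \<Rightarrow> real^4^4) \<Rightarrow> ('a chart \<Rightarrow> real^4 \<Rightarrow> real^4^4)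
      \<Rightarrow> ('a chart \<Rightarrow> real^4 \<Rightarrow> real^4^4) \<Rightarrow> bool" where
  "generalized_kahler A g I J \<longleftrightarrow>
     covariant_2_tensor A g \<and> endomorphism_field A I \<and> endomorphism_field A J \<and>
     (\<forall>c\<in>A. (\<forall>x\<in>chart_img c. riemannian_at (g c x)) \<and>
        compatible_complex_structure_on (chart_img c) (g c) (I c) \<and>
        compatible_complex_structure_on (chart_img c) (g c) (J c) \<and>
        (\<forall>x\<in>chart_img c.
           (\<forall>i j k. dc_kahler_form (g c) (I c) x i j k = - dc_kahler_form (g c) (J c) x i j k) \<and>
           (\<forall>i j k l. ext_deriv_3 (torsion_form (g c) (I c)) x i j k l = 0)))"

definition gk_ricci_soliton ::
    "'a chart set \<Rightarrow> ('a chart \<Rightarrow> real^4 \<Rightarrow> real^4^4) \<Rightarrow> ('a chart \<Rightarrow> real^4 \<Rightarrow> real^4^4)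
      \<Rightarrow> ('a chart \<Rightarrow> real^4 \<Rightarrow> real^4^4) \<Rightarrow> ('a \<Rightarrow> real) \<Rightarrow> bool" where
  "gk_ricci_soliton A g I J f \<longleftrightarrow>
     generalized_kahler A g I J \<and> smooth_function_on A UNIV f \<and>
     (\<forall>c\<in>A. \<forall>x\<in>chart_img c. \<forall>j k.
        let G = bismut (g c) (torsion_form (g c) (I c))
        in ricci G x j k + covariant_hessian G (local_rep f c) x j k = 0)"

text \<open>\<open>X\<^sub>J = J(\<theta>\<^sub>J\<^sup>\<sharp> - \<nabla>f)/2\<close>.\<close>
definition soliton_field ::
    "('a chart \<Rightarrow> real^4 \<Rightarrow> real^4^4) \<Rightarrow> ('a chart \<Rightarrow> real^4 \<Rightarrow> real^4^4) \<Rightarrow> ('a \<Rightarrow> real)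
      \<Rightarrow> 'a chart \<Rightarrow> real^4 \<Rightarrow> real^4" where
  "soliton_field g J f c x =
     (1/2) *\<^sub>R (J c x *v (matrix_inv (g c x) *v
       (lee_form (g c) (J c) x - gradient_covector (local_rep f c) x)))"

definition soliton_rank ::
    "'a chart set \<Rightarrow> ('a chart \<Rightarrow> real^4 \<Rightarrow> real^4^4) \<Rightarrow> ('a chart \<Rightarrow> real^4 \<Rightarrow> real^4^4)
      \<Rightarrow> ('a chart \<Rightarrow> real^4 \<Rightarrow> real^4^4) \<Rightarrow> ('a \<Rightarrow> real) \<Rightarrow> nat" where
  "soliton_rank A g I J f =
     Sup {dim (span {soliton_field g I f c x, soliton_field g J f c x}) | c x.
            c \<in> A \<and> x \<in> chart_img c}"

definition half_commutator :: "real^'n^'n::finite \<Rightarrow> real^'n^'n \<Rightarrow> real^'n^'n" where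
  "half_commutator I J = (1/2) *\<^sub>R (I ** J - J ** I)"

definition poisson_tensor :: "real^'n^'n::finite \<Rightarrow> real^'n^'n \<Rightarrow> real^'n^'n \<Rightarrow> real^'n^'n" where
  "poisson_tensor G I J = half_commutator I J ** matrix_inv G"

definition nondegenerate ::
    "'a chart set \<Rightarrow> ('a chart \<Rightarrow> real^4 \<Rightarrow> real^4^4) \<Rightarrow> ('a chart \<Rightarrow> real^4 \<Rightarrow> real^4^4)
      \<Rightarrow> ('a chart \<Rightarrow> real^4 \<Rightarrow> real^4^4) \<Rightarrow> bool" where
  "nondegenerate A g I J \<longleftrightarrow>
     (\<forall>c\<in>A. \<forall>x\<in>chart_img c. invertible (poisson_tensor (g c x) (I c x) (J c x)))"

text \<open>\<open>\<Omega>(X,Y) = g(K\<^sup>-\<^sup>1 X,Y)\<close> with \<open>K\<close> half the commutator.\<close>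
definition omega_form ::
    "real^'n^'n::finite \<Rightarrow> real^'n^'n \<Rightarrow> real^'n^'n \<Rightarrow> real^'n \<Rightarrow> real^'n \<Rightarrow> real" where
  "omega_form G I J X Y = (matrix_inv (half_commutator I J) *v X) \<bullet> (G *v Y)"

definition angle_function :: "real^'n^'n::finite \<Rightarrow> real^'n^'n \<Rightarrow> real" where
  "angle_function I J = - trace (I ** J) / 4"

definition ricci_potential :: "real^'n^'n::finite \<Rightarrow> real^'n^'n \<Rightarrow> real" where
  "ricci_potential I J = ln ((1 - angle_function I J) / (1 + angle_function I J))"


section \<open>Momenta and functions of the momenta\<close>

text \<open>\<open>\<nu>\<close> is a smooth function on the open set \<open>W\<close> with \<open>\<iota>\<^sub>V \<Omega> = d\<nu>\<close> there.\<close>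
definition momentum_on ::
    "'a chart set \<Rightarrow> ('a chart \<Rightarrow> real^4 \<Rightarrow> real^4^4) \<Rightarrow> ('a chart \<Rightarrow> real^4 \<Rightarrow> real^4^4)
      \<Rightarrow> ('a chart \<Rightarrow> real^4 \<Rightarrow> real^4^4) \<Rightarrow> 'a set \<Rightarrow> ('a chart \<Rightarrow> real^4 \<Rightarrow> real^4)
      \<Rightarrow> ('a \<Rightarrow> real) \<Rightarrow> bool" where
  "momentum_on A g I J W V \<nu> \<longleftrightarrow>
     smooth_function_on A W \<nu> \<and>
     (\<forall>c\<in>A. \<forall>x\<in>chart_map c ` (chart_dom c \<inter> W). \<forall>i.
        omega_form (g c x) (I c x) (J c x) (V c x) (axis i 1) = pd i (local_rep \<nu> c) x)"

definition apply_endo ::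
    "('a chart \<Rightarrow> real^4 \<Rightarrow> real^4^4) \<Rightarrow> ('a chart \<Rightarrow> real^4 \<Rightarrow> real^4)
      \<Rightarrow> 'a chart \<Rightarrow> real^4 \<Rightarrow> real^4" where
  "apply_endo E V c x = E c x *v V c x"

definition invariant_on ::
    "'a chart set \<Rightarrow> 'a set \<Rightarrow> ('a chart \<Rightarrow> real^4 \<Rightarrow> real^4) \<Rightarrow> ('a \<Rightarrow> real) \<Rightarrow> bool" where
  "invariant_on A W V u \<longleftrightarrow>
     (\<forall>c\<in>A. \<forall>x\<in>chart_map c ` (chart_dom c \<inter> W).
        (\<Sum>i\<in>UNIV. V c x $ i * pd i (local_rep u c) x) = 0)"

text \<open>The open set \<open>W\<close> lies in the region where the local orbits of the span of \<open>V\<^sub>1\<close>, \<open>V\<^sub>2\<close>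
  are two-dimensional, so that the space of local orbits is a surface.\<close>
definition regular_domain ::
    "'a topology \<Rightarrow> 'a chart set \<Rightarrow> ('a chart \<Rightarrow> real^4 \<Rightarrow> real^4) \<Rightarrow> ('a chart \<Rightarrow> real^4 \<Rightarrow> real^4)
      \<Rightarrow> 'a set \<Rightarrow> bool" where
  "regular_domain M A V1 V2 W \<longleftrightarrow>
     openin M W \<and>
     (\<forall>c\<in>A. \<forall>x\<in>chart_map c ` (chart_dom c \<inter> W). dim (span {V1 c x, V2 c x}) = 2)"

end

theory Submission
  imports Defs
begin

text \<open>In dimension 4, invertibility of \<open>K\<close> forces \<open>IJ + JI = -2p\<close>, so \<open>L = (I + J)\<inverse>(I - J) = K / (1 + p)\<close>
  satisfies \<open>L\<^sup>2 = -(1 - p) / (1 + p)\<close>. Differentiating the equations for the partial derivatives of \<open>\<phi>\<close>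
  and dualizing with \<open>\<Omega>\<close> expresses \<open>(I - J)X\<^sub>I\<close> and \<open>(I - J)X\<^sub>J\<close> through \<open>(I + J)X\<^sub>I\<close> and
  \<open>(I + J)X\<^sub>J\<close> with coefficients from \<open>Hess(\<phi>)\<close>; so \<open>L\<close> preserves the plane spanned by \<open>X\<^sub>I, X\<^sub>J\<close>,
  with determinant \<open>det(Hess(\<phi>))\<close> there. A real operator on a plane whose square is \<open>-\<lambda> < 0\<close>
  has determinant \<open>\<lambda>\<close>, so \<open>det(Hess(\<phi>)) = (1 - p) / (1 + p) = e\<^sup>\<Phi>\<close>. Replacing \<open>J\<close> by \<open>-J\<close> gives \<open>\<psi>\<close>.\<close>

section \<open>Positive definite matrices and nondegeneracy of \<Omega>\<close>

lemma matrix_inv_mult: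
  fixes A :: "real^'n^'n"
  assumes "invertible A"
  shows "A ** matrix_inv A = mat 1" "matrix_inv A ** A = mat 1"
  using someI_ex[of "\<lambda>B. A ** B = mat 1 \<and> B ** A = mat 1"] assms
  unfolding invertible_def matrix_inv_def by auto

lemma riemannian_at_invertible:
  assumes "riemannian_at G"
  shows "invertible G"
proof -
  have "x = 0" if "G *v x = 0" for x
    using assms that unfolding riemannian_at_def by (metis inner_zero_right less_irrefl)
  then show ?thesis
    by (metis invertible_left_inverse matrix_left_invertible_ker)
qed

lemma riemannian_at_pos: "riemannian_at G \<Longrightarrow> v \<noteq> 0 \<Longrightarrow> v \<bullet> (G *v v) > 0"
  unfolding riemannian_at_def by blast

lemma minus_mat_1_vector: "(- mat 1 :: real^'n^'n) *v x = - x"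
  using matrix_vector_mult_diff_rdistrib[of 0 "mat 1 :: real^'n^'n" x] by simp

lemma matrix_vector_mult_minus: "(A :: real^'n^'m) *v (- x) = - (A *v x)"
  using matrix_vector_mult_diff_distrib[of A 0 x] by simp

text \<open>Nondegeneracy of \<Omega>, used to turn equalities of differentials into equalities of
  vectors. The vector \<open>K\<^sup>-\<^sup>1 (X - Y)\<close> is orthogonal to every coordinate
  vector, hence to itself, so it vanishes, and applying \<open>K\<close> gives
  \<open>X = Y\<close>.\<close>

lemma omega_form_eq_imp_eq:
  assumes G: "riemannian_at G" and K: "invertible (half_commutator I J)"
    and eq: "\<And>i. omega_form G I J X (axis i 1) = omega_form G I J Y (axis i 1)"
  shows "X = Y"
proof -
  let ?w = "matrix_inv (half_commutator I J) *v (X - Y)"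
  have "(?w v* G) $ i = 0" for i
  proof -
    have "?w \<bullet> (G *v axis i 1) = 0"
      using eq[of i] unfolding omega_form_def
      by (simp add: matrix_vector_mult_diff_distrib inner_diff_left)
    then show ?thesis
      by (metis cart_eq_inner_axis dot_lmul_matrix)
  qed
  then have "?w v* G = 0" by (simp add: vec_eq_iff)
  then have "?w \<bullet> (G *v ?w) = 0" by (metis dot_lmul_matrix inner_zero_left)
  then have "?w = 0" using riemannian_at_pos[OF G] by (metis less_irrefl)
  then have "half_commutator I J *v ?w = 0" by simp
  then show ?thesis
    by (simp add: matrix_vector_mul_assoc matrix_inv_mult[OF K])
qed

lemma omega_form_add: "omega_form G I J (X + Y) Z = omega_form G I J X Z + omega_form G I J Y Z"
  and omega_form_scaleR: "omega_form G I J (a *\<^sub>R X) Z = a * omega_form G I J X Z"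
  unfolding omega_form_def
  by (simp_all add: matrix_vector_right_distrib matrix_vector_mult_scaleR inner_add_left)

section \<open>Linear algebra of two Hermitian structures at one point\<close>

locale hermitian_pair =
  fixes G I J :: "real^4^4"
  assumes riemannian: "riemannian_at G"
    and I_square: "I ** I = - mat 1" and I_isometry: "transpose I ** G ** I = G"
    and J_square: "J ** J = - mat 1" and J_isometry: "transpose J ** G ** J = G"
    and commutator_invertible: "invertible (half_commutator I J)"
begin

abbreviation K :: "real^4^4" where "K \<equiv> half_commutator I J"
abbreviation B :: "real^4 \<Rightarrow> real^4 \<Rightarrow> real" where "B x y \<equiv> x \<bullet> (G *v y)"
abbreviation p :: real where "p \<equiv> angle_function I J"

lemma I_I [simp]: "I *v (I *v x) = - x" and J_J [simp]: "J *v (J *v x) = - x"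
  using I_square J_square by (metis matrix_vector_mul_assoc minus_mat_1_vector)+

lemma K_apply: "K *v x = (1/2) *\<^sub>R (I *v (J *v x) - J *v (I *v x))"
  unfolding half_commutator_def
  by (simp add: scaleR_matrix_vector_assoc[symmetric] matrix_vector_mult_diff_rdistrib
      matrix_vector_mul_assoc)

lemmas linear_rules = matrix_vector_right_distrib matrix_vector_mult_diff_distrib
  matrix_vector_mult_scaleR matrix_vector_mult_minus
  inner_add_left inner_diff_left inner_add_right inner_diff_right

lemma B_sym: "B x y = B y x"
proof -
  have "B x y = (x v* G) \<bullet> y" by (simp add: dot_lmul_matrix)
  also have "\<dots> = (G *v x) \<bullet> y"
    using riemannian unfolding riemannian_at_def by (metis transpose_matrix_vector)
  finally show ?thesis by (simp add: inner_commute)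
qed

lemma isometry:
  assumes "transpose E ** G ** E = G"
  shows "B (E *v x) (E *v y) = B x y"
proof -
  have "B x y = x \<bullet> (transpose E *v (G *v (E *v y)))"
    by (metis assms matrix_vector_mul_assoc)
  also have "\<dots> = B (E *v x) (E *v y)"
    by (metis dot_lmul_matrix transpose_transpose transpose_matrix_vector)
  finally show ?thesis by simp
qed

lemma I_skew: "B (I *v x) y = - B x (I *v y)"
  using isometry[OF I_isometry, of "I *v x" y] by simp

lemma J_skew: "B (J *v x) y = - B x (J *v y)"
  using isometry[OF J_isometry, of "J *v x" y] by simp

lemma K_skew: "B (K *v x) y = - B x (K *v y)"
  by (simp add: K_apply linear_rules I_skew J_skew field_simps)

lemma I_K: "I *v (K *v x) = - (K *v (I *v x))"
  by (simp add: K_apply linear_rules vec_eq_iff field_simps)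

lemma K_eq_0: "K *v x = 0 \<Longrightarrow> x = 0"
  by (metis commutator_invertible matrix_inv_mult(2) matrix_vector_mul_assoc
      matrix_vector_mul_lid matrix_vector_mult_0_right)

lemma I_eq_0: "I *v x = 0 \<Longrightarrow> x = 0"
  using I_I[of x] by simp

text \<open>\<open>I\<close> and \<open>K\<close> are skew and anticommute, so \<open>IK\<close> is
  skew as well; this makes the four vectors pairwise orthogonal. They are nonzero because
  \<open>I\<close> and \<open>K\<close> are injective, and four independent vectors fill dimension
  4.\<close>

lemma span_frame:
  assumes "v \<noteq> 0"
  shows "span {v, I *v v, K *v v, I *v (K *v v)} = UNIV"
proof -
  let ?a = v and ?b = "I *v v" and ?c = "K *v v" and ?d = "I *v (K *v v)"
  have pos: "B x x \<noteq> 0" if "x \<noteq> 0" for x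
    using riemannian_at_pos[OF riemannian that] by simp
  have nz: "B ?a ?a \<noteq> 0" "B ?b ?b \<noteq> 0" "B ?c ?c \<noteq> 0" "B ?d ?d \<noteq> 0"
    using assms K_eq_0 I_eq_0 by (metis pos)+
  \<comment> \<open>Stated for every \<open>x\<close> because it is used twice: at \<open>v\<close>,
    and at \<open>K v\<close> for the last two vectors of the frame.\<close>
  have ab: "B x (I *v x) = 0" for x using I_skew[of x x] B_sym[of x "I *v x"] by simp
  have ac: "B ?a ?c = 0" using K_skew[of v v] B_sym[of v ?c] by simp
  have ad: "B ?a ?d = 0"
    using I_skew[of v ?c] K_skew[of ?b v] B_sym[of ?d v] B_sym[of ?b ?c] I_K[of v]
      B_sym[of "K *v ?b" v] by simp
  have bc: "B ?b ?c = 0" using ad I_skew[of v ?c] by simp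
  have bd: "B ?b ?d = 0" using ac isometry[OF I_isometry, of v ?c] by simp
  note orth = ab[of v] ac ad bc bd ab[of ?c]
  have orth'': "B ?b ?a = 0" "B ?c ?a = 0" "B ?d ?a = 0" "B ?c ?b = 0" "B ?d ?b = 0" "B ?d ?c = 0"
    using orth B_sym by metis+
  have dist: "?a \<noteq> ?b" "?a \<noteq> ?c" "?a \<noteq> ?d" "?b \<noteq> ?c" "?b \<noteq> ?d" "?c \<noteq> ?d"
    using orth nz by metis+
  have "independent {?a, ?b, ?c, ?d}"
  proof (rule independent_if_scalars_zero)
    fix s x assume s: "(\<Sum>x\<in>{?a, ?b, ?c, ?d}. s x *\<^sub>R x) = 0" and x: "x \<in> {?a, ?b, ?c, ?d}"
    have e: "s ?a *\<^sub>R ?a + (s ?b *\<^sub>R ?b + (s ?c *\<^sub>R ?c + s ?d *\<^sub>R ?d)) = 0"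
      using s dist by (simp add: sum.insert)
    have "B (s ?a *\<^sub>R ?a + (s ?b *\<^sub>R ?b + (s ?c *\<^sub>R ?c + s ?d *\<^sub>R ?d))) y = 0" for y
      unfolding e by simp
    from this[of ?a] this[of ?b] this[of ?c] this[of ?d]
    show "s x = 0" using x nz orth orth'' by (auto simp: inner_add_left)
  qed simp
  moreover have "card {?a, ?b, ?c, ?d} = 4" using dist by simp
  ultimately show ?thesis
    using card_eq_dim[of "{?a, ?b, ?c, ?d}" "UNIV :: (real^4) set"]
    by (simp add: dim_UNIV independent_card_le) (auto simp: top_unique)
qed

text \<open>The anticommutator \<open>Q\<close> is symmetric and commutes with \<open>I\<close> and \<open>K\<close>, so \<open>Q v\<close> is
  orthogonal to the last three vectors of the orthogonal frame \<open>v, I v, K v, I K v\<close>.\<close>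
lemma anticommutator: "I *v (J *v x) + J *v (I *v x) = (- 2 * p) *\<^sub>R x"
proof -
  define Q where "Q = I ** J + J ** I"
  have Q: "Q *v x = I *v (J *v x) + J *v (I *v x)" for x
    by (simp add: Q_def matrix_vector_mult_add_rdistrib matrix_vector_mul_assoc)
  have QI: "Q *v (I *v x) = I *v (Q *v x)" for x
    by (simp add: Q linear_rules)
  have QK: "Q *v (K *v x) = K *v (Q *v x)" for x
    by (simp add: Q K_apply linear_rules vec_eq_iff field_simps)
  have Qsym: "B (Q *v x) y = B x (Q *v y)" for x y
    by (simp add: Q linear_rules I_skew J_skew)
  obtain v :: "real^4" where v: "v \<noteq> 0" by (metis axis_eq_0_iff zero_neq_one)
  \<comment> \<open>The only possible eigenvalue: \<open>m v\<close> is the orthogonal projection of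
    \<open>Q v\<close> to the line of \<open>v\<close>, and \<open>?u\<close> is the remainder to be
    shown zero.\<close>
  define m where "m = B (Q *v v) v / B v v"
  let ?u = "Q *v v - m *\<^sub>R v"
  have vv: "B v v \<noteq> 0" using riemannian_at_pos[OF riemannian v] by simp
  \<comment> \<open>For skew \<open>E\<close> commuting with \<open>Q\<close>, moving
    \<open>E\<close> and then \<open>Q\<close> across the inner product gives
    \<open>B (Q v) (E v) = - B (Q v) (E v)\<close>. This is applied to \<open>I\<close>,
    \<open>K\<close> and \<open>IK\<close>.\<close>
  have skew_orth: "B (Q *v v) (E *v v) = 0" "B v (E *v v) = 0"
    if E: "\<And>x y. B (E *v x) y = - B x (E *v y)" "\<And>x. Q *v (E *v x) = E *v (Q *v x)" for E
    using E(1)[of "Q *v v" v] E(1)[of v v] Qsym[of v "E *v v"] E(2)[of v]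
      B_sym[of v "E *v v"] B_sym[of "E *v (Q *v v)" v] by simp_all
  have IK_skew: "B ((I ** K) *v x) y = - B x ((I ** K) *v y)" for x y
    by (simp add: matrix_vector_mul_assoc[symmetric] I_skew K_skew I_K)
  have IK_comm: "Q *v ((I ** K) *v x) = (I ** K) *v (Q *v x)" for x
    by (simp add: matrix_vector_mul_assoc[symmetric] QI QK)
  have "B ?u v = 0" using vv by (simp add: m_def linear_rules)
  moreover have "B ?u (I *v v) = 0"
    using skew_orth[OF I_skew QI] by (simp add: linear_rules)
  moreover have "B ?u (K *v v) = 0"
    using skew_orth[OF K_skew QK] by (simp add: linear_rules)
  moreover have "B ?u (I *v (K *v v)) = 0"
    using skew_orth[OF IK_skew IK_comm]
    by (simp add: linear_rules matrix_vector_mul_assoc[symmetric])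
  moreover have "subspace {y. B ?u y = 0}"
    by (auto simp: subspace_def matrix_vector_right_distrib matrix_vector_mult_scaleR
        inner_add_right)
  ultimately have "span {v, I *v v, K *v v, I *v (K *v v)} \<subseteq> {y. B ?u y = 0}"
    by (intro span_minimal) auto
  then have "B ?u ?u = 0" unfolding span_frame[OF v] by blast
  then have Qv: "Q *v v = m *\<^sub>R v"
    using riemannian_at_pos[OF riemannian, of ?u] by fastforce
  \<comment> \<open>One eigenvector suffices: \<open>Q\<close> commutes with \<open>I\<close> and
    \<open>K\<close>, so the whole frame lies in the same eigenspace and \<open>Q\<close> is
    scalar.\<close>
  have "subspace {y. Q *v y = m *\<^sub>R y}"
    by (simp add: subspace_def linear_rules scaleR_add_right)
  then have "span {v, I *v v, K *v v, I *v (K *v v)} \<subseteq> {y. Q *v y = m *\<^sub>R y}"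
    using Qv by (intro span_minimal) (auto simp: QI QK matrix_vector_mult_scaleR)
  then have Qm: "Q *v y = m *\<^sub>R y" for y unfolding span_frame[OF v] by blast
  \<comment> \<open>The scalar is read off from the trace:
    \<open>4 m = tr Q = 2 tr (IJ) = - 8 p\<close>.\<close>
  have "Q $ i $ i = m" for i
    using arg_cong[OF Qm[of "axis i 1"], of "\<lambda>w. w $ i"]
    by (simp add: matrix_vector_mul_component cart_eq_inner_axis[symmetric])
  then have "trace Q = 4 * m" by (simp add: trace_def)
  moreover have "trace Q = 2 * trace (I ** J)"
    unfolding Q_def trace_add by (simp add: trace_mul_sym[of J I])
  ultimately have "m = - 2 * p" by (simp add: angle_function_def)
  then show ?thesis using Qm Q by metis
qed

text \<open>By the anticommutator relation \<open>K = IJ + p\<close>, and \<open>IJ\<close> is a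
  root of \<open>t\<^sup>2 + 2 p t + 1\<close>; completing the square gives the claim.\<close>

lemma K_K: "K *v (K *v x) = (p\<^sup>2 - 1) *\<^sub>R x"
proof -
  have JI: "J *v (I *v y) = (- 2 * p) *\<^sub>R y - I *v (J *v y)" for y
    using anticommutator[of y] by (simp add: algebra_simps)
  have K: "K *v y = I *v (J *v y) + p *\<^sub>R y" for y
    unfolding K_apply JI by (simp add: vec_eq_iff algebra_simps)
  show ?thesis
    unfolding K by (simp add: linear_rules JI vec_eq_iff algebra_simps power2_eq_square)
qed

text \<open>Skewness gives \<open>B (K v) (K v) = (1 - p\<^sup>2) B v v\<close>, and injectivity of
  \<open>K\<close> makes the left side positive. Hence both \<open>1 + p\<close> and
  \<open>1 - p\<close> are positive, as the logarithm in the Ricci potential requires.\<close>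

lemma angle_bound: "\<bar>p\<bar> < 1"
proof -
  obtain v :: "real^4" where v: "v \<noteq> 0" by (metis axis_eq_0_iff zero_neq_one)
  have "B (K *v v) (K *v v) = (1 - p\<^sup>2) * B v v"
    by (simp add: K_skew K_K matrix_vector_mult_scaleR algebra_simps)
  moreover have "B (K *v v) (K *v v) > 0" "B v v > 0"
    using riemannian_at_pos[OF riemannian] v K_eq_0 by blast+
  ultimately have "1 - p\<^sup>2 > 0" by (simp add: zero_less_mult_iff)
  then show ?thesis by (simp add: abs_square_less_1)
qed

text \<open>The hypotheses say \<open>L x = c x + d y\<close> and \<open>L y = - (a x + b y)\<close>
  for \<open>L = (I + J)\<inverse>(I - J)\<close>, so \<open>a d - b c\<close> is the determinant of
  \<open>L\<close> on the plane. Applying \<open>I + J\<close> to both equations avoids the inverse,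
  since \<open>(I + J)(I - J) = - 2 K\<close> and
  \<open>(I + J)\<^sup>2 = - 2 (1 + p)\<close>.\<close>

lemma plane_determinant:
  assumes indep: "\<And>r s. r *\<^sub>R x + s *\<^sub>R y = 0 \<Longrightarrow> r = 0 \<and> s = 0"
    and y: "- (I *v y - J *v y) = a *\<^sub>R (I *v x + J *v x) + b *\<^sub>R (I *v y + J *v y)"
    and x: "I *v x - J *v x = c *\<^sub>R (I *v x + J *v x) + d *\<^sub>R (I *v y + J *v y)"
  shows "a * d - b * c = (1 - p) / (1 + p)"
proof -
  have p: "1 + p > 0" "1 - p > 0" using angle_bound by linarith+
  have minus: "I *v (I *v z - J *v z) + J *v (I *v z - J *v z) = (- 2) *\<^sub>R (K *v z)" for z
    by (simp add: linear_rules K_apply)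
  have plus: "I *v (I *v z + J *v z) + J *v (I *v z + J *v z) = (- 2 * (1 + p)) *\<^sub>R z" for z
    using anticommutator[of z] by (simp add: linear_rules vec_eq_iff) (simp add: algebra_simps)
  have "2 *\<^sub>R (K *v y) = I *v (- (I *v y - J *v y)) + J *v (- (I *v y - J *v y))"
    using minus[of y] by (simp add: linear_rules vec_eq_iff algebra_simps)
  also have "\<dots> = a *\<^sub>R (I *v (I *v x + J *v x) + J *v (I *v x + J *v x))
      + b *\<^sub>R (I *v (I *v y + J *v y) + J *v (I *v y + J *v y))"
    unfolding y by (simp add: linear_rules vec_eq_iff algebra_simps)
  also have "\<dots> = 2 *\<^sub>R (- (1 + p) *\<^sub>R (a *\<^sub>R x + b *\<^sub>R y))"
    unfolding plus by (simp add: vec_eq_iff algebra_simps)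
  finally have Ky: "K *v y = - (1 + p) *\<^sub>R (a *\<^sub>R x + b *\<^sub>R y)"
    by (subst (asm) scaleR_cancel_left) simp
  have "(- 2) *\<^sub>R (K *v x) = c *\<^sub>R (I *v (I *v x + J *v x) + J *v (I *v x + J *v x))
      + d *\<^sub>R (I *v (I *v y + J *v y) + J *v (I *v y + J *v y))"
    unfolding minus[symmetric] x by (simp add: linear_rules vec_eq_iff algebra_simps)
  also have "\<dots> = (- 2) *\<^sub>R ((1 + p) *\<^sub>R (c *\<^sub>R x + d *\<^sub>R y))"
    unfolding plus by (simp add: vec_eq_iff algebra_simps)
  finally have Kx: "K *v x = (1 + p) *\<^sub>R (c *\<^sub>R x + d *\<^sub>R y)"
    by (subst (asm) scaleR_cancel_left) simp
  \<comment> \<open>Both sides are \<open>K (K x)\<close>; comparing coefficients of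
    \<open>x\<close> and \<open>y\<close> gives two scalar equations.\<close>
  have "(p\<^sup>2 - 1) *\<^sub>R x = (1 + p) *\<^sub>R (c *\<^sub>R (K *v x) + d *\<^sub>R (K *v y))"
    using arg_cong[OF Kx, of "\<lambda>z. K *v z"] by (simp add: K_K linear_rules)
  then have "((1 + p)\<^sup>2 * (c\<^sup>2 - a * d) - (p\<^sup>2 - 1)) *\<^sub>R x + ((1 + p)\<^sup>2 * (d * (c - b))) *\<^sub>R y = 0"
    unfolding Kx Ky by (simp add: vec_eq_iff algebra_simps power2_eq_square)
  then have 1: "(1 + p)\<^sup>2 * (c\<^sup>2 - a * d) = p\<^sup>2 - 1" "d * (c - b) = 0"
    using indep p by fastforce+
  \<comment> \<open>If \<open>d = 0\<close>, then \<open>(1 + p)\<^sup>2 c\<^sup>2\<close> would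
    equal the negative number \<open>p\<^sup>2 - 1\<close>. Hence \<open>c = b\<close>: the trace of
    \<open>L\<close> vanishes, which for a Hessian is the equality of the mixed partials.\<close>
  have "p\<^sup>2 < 1" using angle_bound by (simp add: abs_square_less_1)
  moreover have "(1 + p)\<^sup>2 * c\<^sup>2 \<ge> 0" by simp
  ultimately have "d \<noteq> 0" using 1(1) by (intro notI) (simp only: mult_zero_right diff_0_right)
  then have "c = b" using 1(2) by simp
  then have "(1 + p) * ((1 + p) * (a * d - b * c)) = (1 + p) * (1 - p)"
    using 1(1) by (simp add: algebra_simps power2_eq_square)
  then have "(1 + p) * (a * d - b * c) = 1 - p" using p by simp
  then show ?thesis using p by (simp add: eq_divide_eq mult.commute)
qed

end

text \<open>Replacing \<open>J\<close> by \<open>-J\<close> swaps \<open>I + J\<close> with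
  \<open>I - J\<close> and negates \<open>K\<close> and \<open>p\<close>, so
  \<open>plane_determinant\<close> also serves the second potential.\<close>

lemma hermitian_pair_uminus:
  assumes "hermitian_pair G I J"
  shows "hermitian_pair G I (- J)"
proof -
  interpret hermitian_pair G I J by fact
  have m: "(- A) ** C = - (A ** C)" "A ** (- C) = - (A ** C)" "transpose (- A) = - transpose A"
    for A C :: "real^4^4"
    by (simp_all add: matrix_matrix_mult_def vec_eq_iff sum_negf transpose_def)
  have "half_commutator I (- J) = - half_commutator I J"
    by (simp add: half_commutator_def m algebra_simps flip: scaleR_minus_right)
  moreover have "invertible (- A)" if "invertible A" for A :: "real^4^4"
    using that unfolding invertible_def by (metis m(1,2) minus_minus)
  ultimately show ?thesis
    using riemannian I_square I_isometry J_square J_isometry commutator_invertible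
    by unfold_locales (simp_all add: m)
qed

lemma angle_function_uminus: "angle_function I (- J) = - angle_function I J"
  by (simp add: angle_function_def trace_def matrix_matrix_mult_def sum_negf)

section \<open>Hamiltonian functions at a point and the chain rule\<close>

lemma pd_eq: "(f has_derivative D) (at x) \<Longrightarrow> pd i f x = D (axis i 1)"
  unfolding pd_def by (metis frechet_derivative_at)

text \<open>The pointwise form of \<open>momentum_on\<close>: \<open>V\<close> is a single tangent
  vector and \<open>u\<close> need only be differentiable at \<open>x\<close>, which is what the
  chain rule uses.\<close>

definition hamiltonian_at ::
    "real^'n^'n::finite \<Rightarrow> real^'n^'n \<Rightarrow> real^'n^'n \<Rightarrow> real^'n \<Rightarrow> real^'n \<Rightarrow> (real^'n \<Rightarrow> real) \<Rightarrow> bool"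
  where "hamiltonian_at G I J x V u \<longleftrightarrow>
    u differentiable (at x) \<and> (\<forall>i. omega_form G I J V (axis i 1) = pd i u x)"

lemma hamiltonian_at_linear_combination:
  assumes "hamiltonian_at G I J x U u" "hamiltonian_at G I J x V v"
  shows "hamiltonian_at G I J x (a *\<^sub>R U + b *\<^sub>R V) (\<lambda>y. a * u y + b * v y)"
proof -
  have "((\<lambda>y. a * u y + b * v y) has_derivative
      (\<lambda>h. a * frechet_derivative u (at x) h + b * frechet_derivative v (at x) h)) (at x)"
    using assms[unfolded hamiltonian_at_def frechet_derivative_works]
    by (auto intro!: derivative_eq_intros)
  from pd_eq[OF this] this show ?thesis
    using assms unfolding hamiltonian_at_def
    by (auto simp: pd_def omega_form_add omega_form_scaleR intro: differentiableI)
qed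

lemma pd_chain_2:
  fixes F :: "real^2 \<Rightarrow> real" and u v h :: "real^'n \<Rightarrow> real"
  assumes F: "F differentiable (at (vector [u x, v x]))"
    and u: "u differentiable (at x)" and v: "v differentiable (at x)"
    and S: "open S" "x \<in> S" and h: "\<And>y. y \<in> S \<Longrightarrow> h y = F (vector [u y, v y])"
  shows "pd i h x = pd 1 F (vector [u x, v x]) * pd i u x + pd 2 F (vector [u x, v x]) * pd i v x"
proof -
  let ?c = "\<lambda>y. vector [u y, v y] :: real^2"
  let ?Dc = "\<lambda>h. frechet_derivative u (at x) h *\<^sub>R axis 1 1 + frechet_derivative v (at x) h *\<^sub>R axis 2 1 :: real^2"
  let ?DF = "frechet_derivative F (at (?c x))"
  have c: "vector [s, t] = s *\<^sub>R axis 1 1 + t *\<^sub>R (axis 2 1 :: real^2)" for s t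
    by (simp add: vec_eq_iff forall_2 axis_def)
  have "(?c has_derivative ?Dc) (at x)"
    unfolding c using u[unfolded frechet_derivative_works] v[unfolded frechet_derivative_works]
    by (auto intro!: derivative_eq_intros)
  moreover have DF: "(F has_derivative ?DF) (at (?c x))"
    using F by (simp add: frechet_derivative_works)
  ultimately have "((\<lambda>y. F (?c y)) has_derivative (\<lambda>h. ?DF (?Dc h))) (at x)"
    using diff_chain_at[of ?c ?Dc x F ?DF] by (simp add: o_def)
  \<comment> \<open>\<open>h\<close> agrees with the composite only on \<open>S\<close>; openness of
    \<open>S\<close> transfers the derivative.\<close>
  then have "(h has_derivative (\<lambda>h. ?DF (?Dc h))) (at x)"
    by (rule has_derivative_transform_within_open[OF _ S]) (simp add: h)
  from pd_eq[OF this, of i] show ?thesis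
    using has_derivative_linear[OF DF] by (simp add: pd_def linear_add linear_cmul mult.commute)
qed

section \<open>From the manifold to coordinates\<close>

lemma open_chart_image:
  assumes "is_chart M c" "openin M W"
  shows "open (chart_map c ` (chart_dom c \<inter> W))"
proof -
  have "openin (subtopology M (chart_dom c)) (chart_dom c \<inter> W)"
    using assms(2) by (simp add: openin_subtopology_Int2)
  then have "openin (top_of_set (chart_img c)) (chart_map c ` (chart_dom c \<inter> W))"
    using assms(1) unfolding is_chart_def
    by (metis homeomorphic_imp_open_map open_map_def)
  then show ?thesis
    using assms(1) unfolding is_chart_def by (metis openin_open_eq)
qed

lemma chart_inv_map:
  assumes "is_chart M c" "q \<in> chart_dom c"
  shows "chart_inv c (chart_map c q) = q"
proof -
  have "topspace (subtopology M (chart_dom c)) = chart_dom c"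
    using assms(1) openin_subset unfolding is_chart_def by (simp add: inf.absorb_iff2) blast
  then have "inj_on (chart_map c) (chart_dom c)"
    using assms(1) homeomorphic_imp_injective_map unfolding is_chart_def by metis
  then show ?thesis using assms(2) by (simp add: chart_inv_def)
qed

lemma smooth_on_differentiable: "smooth_on S f \<Longrightarrow> x \<in> S \<Longrightarrow> f differentiable (at x)"
  unfolding smooth_on_def by (metis Ck_on.simps(2))

lemma smooth_on_pd_differentiable: "smooth_on S f \<Longrightarrow> x \<in> S \<Longrightarrow> pd i f differentiable (at x)"
  unfolding smooth_on_def by (metis Ck_on.simps(2))

text \<open>The chain rule \<open>dh = F\<^sub>1 du + F\<^sub>2 dv\<close>, dualized by the
  nondegenerate \<Omega>, becomes a linear relation between the Hamiltonian vectors.\<close>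

lemma hamiltonian_at_chain:
  fixes F :: "real^2 \<Rightarrow> real"
  assumes G: "riemannian_at G" "invertible (half_commutator I J)"
    and u: "hamiltonian_at G I J x U u" and v: "hamiltonian_at G I J x V v"
    and h: "hamiltonian_at G I J x H h"
    and F: "F differentiable (at (vector [u x, v x]))"
    and S: "open S" "x \<in> S" "\<And>y. y \<in> S \<Longrightarrow> h y = F (vector [u y, v y])"
  shows "H = pd 1 F (vector [u x, v x]) *\<^sub>R U + pd 2 F (vector [u x, v x]) *\<^sub>R V"
proof (rule omega_form_eq_imp_eq[OF G])
  fix i
  show "omega_form G I J H (axis i 1) = omega_form G I J
      (pd 1 F (vector [u x, v x]) *\<^sub>R U + pd 2 F (vector [u x, v x]) *\<^sub>R V) (axis i 1)"
    using pd_chain_2[where F = F and h = h and u = u and v = v and x = x and i = i, OF F _ _ S] u v h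
    by (simp add: hamiltonian_at_def omega_form_add omega_form_scaleR)
qed

lemma momentum_on_hamiltonian_at:
  assumes "momentum_on A g I J W V \<nu>" "c \<in> A" "x \<in> chart_map c ` (chart_dom c \<inter> W)"
  shows "hamiltonian_at (g c x) (I c x) (J c x) x (V c x) (local_rep \<nu> c)"
  using assms smooth_on_differentiable
  unfolding momentum_on_def smooth_function_on_def hamiltonian_at_def by blast

lemma dim_span_pair_eq_2:
  fixes x y :: "'a::euclidean_space"
  assumes "dim (span {x, y}) = 2" "r *\<^sub>R x + s *\<^sub>R y = 0"
  shows "r = 0 \<and> s = 0"
proof -
  have "x \<noteq> y"
    using assms(1) dim_le_card[of "{x}" "{x}"] by (auto simp: span_superset)
  moreover have "independent {x, y}"
    using assms(1) calculation by (intro card_le_dim_spanning[of _ "span {x, y}"]) (auto simp: span_base)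
  ultimately show ?thesis
    using assms(2) independentD[of "{x, y}" "{x, y}" "\<lambda>z. if z = x then r else s"] by force
qed

lemma gk_hermitian_pair:
  assumes "generalized_kahler A g I J" "nondegenerate A g I J" "c \<in> A" "x \<in> chart_img c"
  shows "hermitian_pair (g c x) (I c x) (J c x)"
proof -
  have riem: "riemannian_at (g c x)"
    and IJ: "I c x ** I c x = - mat 1" "transpose (I c x) ** g c x ** I c x = g c x"
      "J c x ** J c x = - mat 1" "transpose (J c x) ** g c x ** J c x = g c x"
    using assms unfolding generalized_kahler_def compatible_complex_structure_on_def by blast+
  have "invertible (half_commutator (I c x) (J c x) ** matrix_inv (g c x))"
    using assms unfolding nondegenerate_def poisson_tensor_def by blast
  \<comment> \<open>Multiplying \<sigma> by the metric on the right recovers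
    \<open>K\<close>.\<close>
  then have "invertible (half_commutator (I c x) (J c x) ** matrix_inv (g c x) ** g c x)"
    using riemannian_at_invertible[OF riem] by (rule invertible_mult)
  then have "invertible (half_commutator (I c x) (J c x))"
    by (simp add: matrix_mul_assoc[symmetric] matrix_inv_mult riemannian_at_invertible[OF riem])
  then show ?thesis using riem IJ by unfold_locales
qed

section \<open>The Monge-Ampere equations for both potentials\<close>

theorem proposition4p7:
  fixes M :: "'a topology" and A :: "'a chart set"
    and g I J :: "'a chart \<Rightarrow> real^4 \<Rightarrow> real^4^4"
    and f :: "'a \<Rightarrow> real"
    and X\<^sub>I X\<^sub>J :: "'a chart \<Rightarrow> real^4 \<Rightarrow> real^4"
    and W :: "'a set"
    and nuI1 nuI2 nuI3 nuJ1 nuJ2 nuJ3 :: "'a \<Rightarrow> real"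
    and nuIp nuIm nuJp nuJm :: "'a \<Rightarrow> real"
    and cp cm :: "'a \<Rightarrow> real^2"
    and \<phi> \<psi> :: "real^2 \<Rightarrow> real"
  assumes manifold: "smooth_4_manifold M A"
    and soliton: "gk_ricci_soliton A g I J f"
    and nondeg: "nondegenerate A g I J"
    and rank: "soliton_rank A g I J f = 2"
    and X\<^sub>I: "X\<^sub>I = soliton_field g I f" and X\<^sub>J: "X\<^sub>J = soliton_field g J f"
    and W: "regular_domain M A X\<^sub>I X\<^sub>J W"
    and momenta_I: "momentum_on A g I J W X\<^sub>I nuI1"
      "momentum_on A g I J W (apply_endo I X\<^sub>I) nuI2"
      "momentum_on A g I J W (apply_endo J X\<^sub>I) nuI3"
    and momenta_J: "momentum_on A g I J W X\<^sub>J nuJ1"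
      "momentum_on A g I J W (apply_endo I X\<^sub>J) nuJ2"
      "momentum_on A g I J W (apply_endo J X\<^sub>J) nuJ3"
    and normalization: "\<forall>c\<in>A. \<forall>q\<in>chart_dom c \<inter> W.
      ricci_potential (I c (chart_map c q)) (J c (chart_map c q)) = 2 * nuJ3 q - 2 * nuI2 q"
    and nu_I: "nuIp = (\<lambda>q. (nuI2 q + nuI3 q) / 2)" "nuIm = (\<lambda>q. (nuI2 q - nuI3 q) / 2)"
    and nu_J: "nuJp = (\<lambda>q. (nuJ2 q + nuJ3 q) / 2)" "nuJm = (\<lambda>q. (nuJ2 q - nuJ3 q) / 2)"
    and coords: "cp = (\<lambda>q. vector [nuIp q, nuJp q])" "cm = (\<lambda>q. vector [nuIm q, nuJm q])"
    and phi_smooth: "smooth_on (cp ` W) \<phi>"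
    and phi_invariant: "invariant_on A W X\<^sub>I (\<phi> \<circ> cp)" "invariant_on A W X\<^sub>J (\<phi> \<circ> cp)"
    and phi_partials: "\<forall>q\<in>W. pd 1 \<phi> (cp q) = - nuJm q \<and> pd 2 \<phi> (cp q) = nuIm q"
    and psi_smooth: "smooth_on (cm ` W) \<psi>"
    and psi_invariant: "invariant_on A W X\<^sub>I (\<psi> \<circ> cm)" "invariant_on A W X\<^sub>J (\<psi> \<circ> cm)"
    and psi_partials: "\<forall>q\<in>W. pd 1 \<psi> (cm q) = nuJp q \<and> pd 2 \<psi> (cm q) = - nuIp q"
  shows "\<forall>q\<in>W.
      det (hessian \<phi> (cp q)) = exp (2 * (nuJp q - nuIp q - pd 2 \<phi> (cp q) + pd 1 \<phi> (cp q))) \<and>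
      det (hessian \<psi> (cm q)) = exp (2 * (nuIm q + nuJm q - pd 1 \<psi> (cm q) - pd 2 \<psi> (cm q)))"
proof
  fix q assume q: "q \<in> W"
  have openW: "openin M W" using W by (simp add: regular_domain_def)
  have "q \<in> topspace M" using openin_subset[OF openW] q by blast
  also have "topspace M = (\<Union>c\<in>A. chart_dom c)"
    using manifold by (simp add: smooth_4_manifold_def)
  finally obtain c where c: "c \<in> A" "q \<in> chart_dom c" by blast
  define x where "x = chart_map c q"
  define S where "S = chart_map c ` (chart_dom c \<inter> W)"
  have chart: "is_chart M c" using manifold c by (simp add: smooth_4_manifold_def)
  have S: "open S" "x \<in> S"
    using open_chart_image[OF chart openW] q c by (auto simp: S_def x_def)
  have inv: "chart_inv c y \<in> W" if "y \<in> S" for y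
    using that chart_inv_map[OF chart] unfolding S_def by auto
  let ?G = "g c x" and ?I = "I c x" and ?J = "J c x" and ?X = "X\<^sub>I c x" and ?Y = "X\<^sub>J c x"
  have gk: "generalized_kahler A g I J" using soliton by (simp add: gk_ricci_soliton_def)
  have "x \<in> chart_img c" using c by (simp add: x_def chart_img_def)
  then interpret pair: hermitian_pair ?G ?I ?J
    by (rule gk_hermitian_pair[OF gk nondeg c(1)])
  interpret conj: hermitian_pair ?G ?I "- ?J"
    by (rule hermitian_pair_uminus) (fact pair.hermitian_pair_axioms)
  have "\<forall>c\<in>A. \<forall>x\<in>chart_map c ` (chart_dom c \<inter> W). dim (span {X\<^sub>I c x, X\<^sub>J c x}) = 2"
    using W unfolding regular_domain_def by (rule conjunct2)
  then have dim2: "dim (span {?X, ?Y}) = 2"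
    using c(1) S(2) unfolding S_def by blast
  have indep: "\<And>r s. r *\<^sub>R ?X + s *\<^sub>R ?Y = 0 \<Longrightarrow> r = 0 \<and> s = 0"
    by (rule dim_span_pair_eq_2[OF dim2])
  have ham: "hamiltonian_at ?G ?I ?J x (V c x) (local_rep \<nu> c)"
    if "momentum_on A g I J W V \<nu>" for V \<nu>
    using momentum_on_hamiltonian_at[OF that c(1)] S(2) unfolding S_def .
  have comb: "hamiltonian_at ?G ?I ?J x (a *\<^sub>R (?I *v V c x) + b *\<^sub>R (?J *v V c x))
      (\<lambda>y. a * local_rep \<nu> c y + b * local_rep \<nu>' c y)"
    if "momentum_on A g I J W (apply_endo I V) \<nu>" "momentum_on A g I J W (apply_endo J V) \<nu>'"
    for V \<nu> \<nu>' a b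
    using hamiltonian_at_linear_combination[OF ham[OF that(1)] ham[OF that(2)]]
    by (simp add: apply_endo_def)
  note combI = comb[OF momenta_I(2,3)] and combJ = comb[OF momenta_J(2,3)]
  note chain = hamiltonian_at_chain[OF pair.riemannian pair.commutator_invertible _ _ _ _ S]
  \<comment> \<open>The momenta are written with explicit coefficients so that they match the linear
    combinations produced by \<open>comb\<close>.\<close>
  have cpx: "vector [1/2 * local_rep nuI2 c y + 1/2 * local_rep nuI3 c y,
      1/2 * local_rep nuJ2 c y + 1/2 * local_rep nuJ3 c y] = cp (chart_inv c y)" for y
    unfolding coords nu_I nu_J local_rep_def by (simp add: add_divide_distrib)
  have cmx: "vector [1/2 * local_rep nuI2 c y + (-1/2) * local_rep nuI3 c y,
      1/2 * local_rep nuJ2 c y + (-1/2) * local_rep nuJ3 c y] = cm (chart_inv c y)" for y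
    unfolding coords nu_I nu_J local_rep_def by (simp add: diff_divide_distrib)
  have qx: "chart_inv c x = q" using chart_inv_map[OF chart c(2)] by (simp add: x_def)
  have phi_diff: "pd i \<phi> differentiable (at (cp q))" for i
    using smooth_on_pd_differentiable[OF phi_smooth] q by blast
  have psi_diff: "pd i \<psi> differentiable (at (cm q))" for i
    using smooth_on_pd_differentiable[OF psi_smooth] q by blast
  \<comment> \<open>The relation \<open>\<phi>\<^sub>1 = - nuJm\<close> differentiated:
    \<open>nuIp\<close>, \<open>nuJp\<close> and \<open>- nuJm\<close> have Hamiltonian vectors
    \<open>(I + J) X\<^sub>I / 2\<close>, \<open>(I + J) X\<^sub>J / 2\<close> and
    \<open>- (I - J) X\<^sub>J / 2\<close>. The six instantiated numbers are their coefficients, in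
    this order.\<close>
  have phi1: "(-1/2) *\<^sub>R (?I *v ?Y) + (1/2) *\<^sub>R (?J *v ?Y) =
      pd 1 (pd 1 \<phi>) (cp q) *\<^sub>R ((1/2) *\<^sub>R (?I *v ?X) + (1/2) *\<^sub>R (?J *v ?X)) +
      pd 2 (pd 1 \<phi>) (cp q) *\<^sub>R ((1/2) *\<^sub>R (?I *v ?Y) + (1/2) *\<^sub>R (?J *v ?Y))"
    using chain[OF combI combJ combJ, where F = "pd 1 \<phi>", of "1/2" "1/2" "1/2" "1/2" "-1/2" "1/2"]
    unfolding cpx qx using phi_diff inv phi_partials
    by (simp add: nu_J local_rep_def diff_divide_distrib)
  have phi2: "(1/2) *\<^sub>R (?I *v ?X) + (-1/2) *\<^sub>R (?J *v ?X) =
      pd 1 (pd 2 \<phi>) (cp q) *\<^sub>R ((1/2) *\<^sub>R (?I *v ?X) + (1/2) *\<^sub>R (?J *v ?X)) +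
      pd 2 (pd 2 \<phi>) (cp q) *\<^sub>R ((1/2) *\<^sub>R (?I *v ?Y) + (1/2) *\<^sub>R (?J *v ?Y))"
    using chain[OF combI combJ combI, where F = "pd 2 \<phi>", of "1/2" "1/2" "1/2" "1/2" "1/2" "-1/2"]
    unfolding cpx qx using phi_diff inv phi_partials
    by (simp add: nu_I local_rep_def diff_divide_distrib)
  \<comment> \<open>For \<psi> the coordinates are generated by \<open>I - J\<close> and the values
    by \<open>I + J\<close>.\<close>
  have psi1: "(1/2) *\<^sub>R (?I *v ?Y) + (1/2) *\<^sub>R (?J *v ?Y) =
      pd 1 (pd 1 \<psi>) (cm q) *\<^sub>R ((1/2) *\<^sub>R (?I *v ?X) + (-1/2) *\<^sub>R (?J *v ?X)) +
      pd 2 (pd 1 \<psi>) (cm q) *\<^sub>R ((1/2) *\<^sub>R (?I *v ?Y) + (-1/2) *\<^sub>R (?J *v ?Y))"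
    using chain[OF combI combJ combJ, where F = "pd 1 \<psi>", of "1/2" "-1/2" "1/2" "-1/2" "1/2" "1/2"]
    unfolding cmx qx using psi_diff inv psi_partials
    by (simp add: nu_J local_rep_def add_divide_distrib)
  have psi2: "(-1/2) *\<^sub>R (?I *v ?X) + (-1/2) *\<^sub>R (?J *v ?X) =
      pd 1 (pd 2 \<psi>) (cm q) *\<^sub>R ((1/2) *\<^sub>R (?I *v ?X) + (-1/2) *\<^sub>R (?J *v ?X)) +
      pd 2 (pd 2 \<psi>) (cm q) *\<^sub>R ((1/2) *\<^sub>R (?I *v ?Y) + (-1/2) *\<^sub>R (?J *v ?Y))"
    using chain[OF combI combJ combI, where F = "pd 2 \<psi>", of "1/2" "-1/2" "1/2" "-1/2" "-1/2" "-1/2"]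
    unfolding cmx qx using psi_diff inv psi_partials
    by (simp add: nu_I local_rep_def add_divide_distrib)
  let ?p = "angle_function ?I ?J"
  have p: "1 + ?p > 0" "1 - ?p > 0" using pair.angle_bound by linarith+
  have "pd 1 (pd 1 \<phi>) (cp q) * pd 2 (pd 2 \<phi>) (cp q) - pd 2 (pd 1 \<phi>) (cp q) * pd 1 (pd 2 \<phi>) (cp q)
      = (1 - ?p) / (1 + ?p)"
    using arg_cong[OF phi1, of "\<lambda>v. 2 *\<^sub>R v"] arg_cong[OF phi2, of "\<lambda>v. 2 *\<^sub>R v"]
    by (intro pair.plane_determinant[OF indep]) (simp_all add: scaleR_add_right scaleR_diff_right)
  then have det_phi: "det (hessian \<phi> (cp q)) = (1 - ?p) / (1 + ?p)"
    by (simp add: det_2 hessian_def mult.commute)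
  have mJ: "- ?J *v v = - (?J *v v)" for v
    using matrix_vector_mult_diff_rdistrib[of 0 ?J v] by simp
  \<comment> \<open>Scaling by \<open>-2\<close> brings the relations to the form required for the
    pair \<open>I, -J\<close>. All four Hessian entries change sign, which leaves the determinant
    unchanged, while \<open>p\<close> becomes \<open>-p\<close> and the ratio is inverted.\<close>
  have "(- pd 1 (pd 1 \<psi>) (cm q)) * (- pd 2 (pd 2 \<psi>) (cm q)) - (- pd 2 (pd 1 \<psi>) (cm q)) * (- pd 1 (pd 2 \<psi>) (cm q))
      = (1 - conj.p) / (1 + conj.p)"
    using arg_cong[OF psi1, of "\<lambda>v. (-2) *\<^sub>R v"] arg_cong[OF psi2, of "\<lambda>v. (-2) *\<^sub>R v"]
    by (intro conj.plane_determinant[OF indep])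
      (simp_all add: mJ scaleR_add_right scaleR_diff_right)
  then have det_psi: "det (hessian \<psi> (cm q)) = (1 + ?p) / (1 - ?p)"
    by (simp add: det_2 hessian_def mult.commute angle_function_uminus)
  have rp: "ln ((1 - ?p) / (1 + ?p)) = 2 * nuJ3 q - 2 * nuI2 q"
    using normalization c q by (simp add: ricci_potential_def x_def)
  have "(1 - ?p) / (1 + ?p) = exp (2 * nuJ3 q - 2 * nuI2 q)"
    unfolding rp[symmetric] using p by (simp add: exp_ln)
  moreover have "(1 + ?p) / (1 - ?p) = exp (- (2 * nuJ3 q - 2 * nuI2 q))"
    unfolding exp_minus calculation[symmetric] by simp
  \<comment> \<open>Inserting the first partials turns the exponent into \<Phi>, and below for
    \<psi> into its negative.\<close>
  moreover have "2 * (nuJp q - nuIp q - pd 2 \<phi> (cp q) + pd 1 \<phi> (cp q)) = 2 * nuJ3 q - 2 * nuI2 q"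
    using bspec[OF phi_partials q] by (simp add: nu_I nu_J field_simps)
  moreover have "2 * (nuIm q + nuJm q - pd 1 \<psi> (cm q) - pd 2 \<psi> (cm q)) = - (2 * nuJ3 q - 2 * nuI2 q)"
    using bspec[OF psi_partials q] by (simp add: nu_I nu_J field_simps)
  ultimately show "det (hessian \<phi> (cp q)) = exp (2 * (nuJp q - nuIp q - pd 2 \<phi> (cp q) + pd 1 \<phi> (cp q))) \<and>
      det (hessian \<psi> (cm q)) = exp (2 * (nuIm q + nuJm q - pd 1 \<psi> (cm q) - pd 2 \<psi> (cm q)))"
    using det_phi det_psi by simp
qed

end
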